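(* For every $n\in\mathbb{N}$, $n\ge 1$, and every prime number $p>2$, the Lusternik–Schnirelmann category of the moment angle complex of $X(\mathbb{F}_p^n)$ is $$\mathrm{cat}(\mathcal{Z}_{X(\mathbb{F}_p^n)})=n.$$
   Context: $X(\mathbb{F}_p^n)$ is the simplicial complex whose vertices are the nonzero vectors of $\mathbb{F}_p^n$ and whose simplices are the linearly independent subsets of $\mathbb{F}_p^n$. For a simplicial complex $\mathcal{K}$ on $[m]$, the moment angle complex is $\mathcal{Z}_{\mathcal{K}}=\bigcup_{\sigma\in\mathcal{K}}\prod_{i=1}^mY_i^\sigma\subseteq(D^2)^m$, where $Y_i^\sigma=D^2$ if $i\in\sigma$ and $Y_i^\sigma=S^1=\partial D^2$ if $i\notin\sigma$. The Lusternik–Schnirelmann category $\mathrm{cat}(Y)$ of a space $Y$ is the smallest integer $k$ such that $Y$ admits a covering by $k+1$ open sets each contractible in $Y$. *)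

theory Defs
  imports
    "HOL-Analysis.Analysis"
    "HOL-Library.Extended_Nat"
    "Berlekamp_Zassenhaus.Finite_Field"
begin

text \<open>Simplicial complexes are given by a vertex set together with the set of all their simplices,
  the empty simplex included.\<close>

definition nonzero_vectors :: "('k::field ^ 'n) set" where
  "nonzero_vectors = {v. v \<noteq> 0}"

definition independence_complex :: "('k::field ^ 'n) set set" where
  "independence_complex = {\<sigma>. vec.independent \<sigma>}"

text \<open>The coordinates are indexed by the vertex set \<open>V\<close> itself instead of an enumeration of it;
  points are functions that are \<open>undefined\<close> outside \<open>V\<close>, as in \<^const>\<open>product_topology\<close>.\<close>

definition moment_angle_complex :: "'v set \<Rightarrow> 'v set set \<Rightarrow> ('v \<Rightarrow> complex) topology" where
  "moment_angle_complex V K =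
     subtopology (product_topology (\<lambda>_. top_of_set (cball 0 1)) V)
       (\<Union>\<sigma>\<in>K. \<Pi>\<^sub>E i\<in>V. if i \<in> \<sigma> then cball 0 1 else sphere 0 1)"

text \<open>The null-homotopy of the inclusion \<open>U \<hookrightarrow> Y\<close> runs in \<open>Y\<close>, not in \<open>U\<close>.\<close>

definition contractible_in :: "'a topology \<Rightarrow> 'a set \<Rightarrow> bool" where
  "contractible_in Y U \<longleftrightarrow>
     (\<exists>a. homotopic_with (\<lambda>_. True) (subtopology Y U) Y id (\<lambda>_. a))"

text \<open>Infimum in \<^typ>\<open>enat\<close>: the least such \<open>k\<close>, and \<open>\<infinity>\<close> if there is none.\<close>

definition LS_category :: "'a topology \<Rightarrow> enat" where
  "LS_category Y = Inf (enat ` {k. \<exists>U :: nat \<Rightarrow> 'a set.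
     (\<forall>i\<le>k. openin Y (U i) \<and> contractible_in Y (U i)) \<and> (\<Union>i\<le>k. U i) = topspace Y})"

end

(* Upper bound: stratify the moment angle complex by the set of coordinates in the interior of the
   disc. The strata belonging to simplices of the same cardinality have disjoint open neighbourhoods,
   each of which deforms into the torus (all coordinates on the circle), and the torus is contracted
   one coordinate at a time through the discs of the vertices. Simplices have 0, ..., n elements.

   Lower bound: the vertices e_i and c e_i with c different from 0 and 1 exhibit (S^3)^n as a retract.
   If n open sets that are contractible in it covered (S^3)^n, then, by homotopy extension, the i-th
   projection would be homotopic to a map constant on the i-th set (slightly shrunk). So the identity
   would be homotopic to a map into a fat wedge, in particular to a map that is not surjective.
   Instead of a degree, the contradiction uses Borsuk's separation criterion: (S^3)^n times the
   boundary of an n-cube is a hypersurface in (R^4)^n which bounds, and which would be homotopic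
   within itself to a set that no longer separates a point q inside it from infinity. *)

theory Submission
  imports Defs
begin

section \<open>Continuity, openness and gluing of homotopies\<close>

lemma continuous_map_scaleR:
  fixes g :: "'a \<Rightarrow> 'b::real_normed_vector"
  assumes "continuous_map X euclidean f" "continuous_map X euclidean g"
  shows "continuous_map X euclidean (\<lambda>x. f x *\<^sub>R g x)"
  using assms by (simp add: continuous_map_atin tendsto_scaleR)

lemma openin_Collect_ball_finite:
  assumes "finite F" "\<And>w. w \<in> F \<Longrightarrow> openin X {x \<in> topspace X. P w x}"
  shows "openin X {x \<in> topspace X. \<forall>w\<in>F. P w x}"
  using assms
proof (induction F rule: finite_induct)
  case (insert a F)
  have "{x \<in> topspace X. \<forall>w\<in>insert a F. P w x}
      = {x \<in> topspace X. P a x} \<inter> {x \<in> topspace X. \<forall>w\<in>F. P w x}"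
    by auto
  then show ?case using insert by (simp add: openin_Int)
qed simp

lemma openin_Collect_less:
  fixes f g :: "'a \<Rightarrow> real"
  assumes "continuous_map X euclidean f" "continuous_map X euclidean g"
  shows "openin X {x \<in> topspace X. f x < g x}"
proof -
  have "continuous_map X euclidean (\<lambda>x. g x - f x)"
    using assms by (intro continuous_map_diff)
  from openin_continuous_map_preimage[OF this, of "{0<..}"] show ?thesis by simp
qed

lemma homotopic_with_TrueI:
  assumes "continuous_map (prod_topology (top_of_set {0..1::real}) X) Y h"
    and "\<And>x. x \<in> topspace X \<Longrightarrow> h (0, x) = f x" "\<And>x. x \<in> topspace X \<Longrightarrow> h (1, x) = g x"
  shows "homotopic_with (\<lambda>_. True) X Y f g"
  using assms by (subst homotopic_with) (simp, blast)

text \<open>Disjointness lets each piece carry its own homotopy, and openness of the pieces makes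
  the glued map continuous. The ends \<open>f\<close> and \<open>g\<close> are common to all pieces;
  in the application they are the inclusion and one fixed constant map.\<close>

lemma homotopic_with_disjoint_Union:
  assumes ope: "\<And>i. i \<in> I \<Longrightarrow> openin Y (U i)"
    and disj: "\<And>i j. i \<in> I \<Longrightarrow> j \<in> I \<Longrightarrow> i \<noteq> j \<Longrightarrow> U i \<inter> U j = {}"
    and hom: "\<And>i. i \<in> I \<Longrightarrow> homotopic_with (\<lambda>_. True) (subtopology Y (U i)) Z f g"
  shows "homotopic_with (\<lambda>_. True) (subtopology Y (\<Union>i\<in>I. U i)) Z f g"
proof -
  let ?T = "top_of_set {0..1::real}"
  let ?X = "prod_topology ?T (subtopology Y (\<Union>i\<in>I. U i))"
  obtain h where h: "\<And>i. i \<in> I \<Longrightarrow> continuous_map (prod_topology ?T (subtopology Y (U i))) Z (h i)"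
    and h0: "\<And>i x. i \<in> I \<Longrightarrow> h i (0, x) = f x" and h1: "\<And>i x. i \<in> I \<Longrightarrow> h i (1, x) = g x"
    using hom unfolding homotopic_with_def by metis
  define c where "c x = (SOME i. i \<in> I \<and> x \<in> U i)" for x
  have c: "c x = i" if "i \<in> I" "x \<in> U i" for i x
    unfolding c_def using that disj by (intro some_equality) blast+
  define H where "H p = h (c (snd p)) p" for p
  have "continuous_map ?X Z H"
  proof (rule pasting_lemma[where I = I and T = "\<lambda>i. {0..1} \<times> U i" and f = h])
    fix i assume i: "i \<in> I"
    have Ui: "U i \<subseteq> (\<Union>i\<in>I. U i)" using i by blast
    then have "openin (subtopology Y (\<Union>i\<in>I. U i)) (U i)"
      using ope[OF i] by (auto simp: openin_subtopology)
    then show "openin ?X ({0..1} \<times> U i)"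
      by (simp add: openin_prod_Times_iff)
    have "subtopology ?X ({0..1} \<times> U i) = prod_topology ?T (subtopology Y (U i))"
      using Ui by (simp add: subtopology_Times subtopology_subtopology Int_absorb1)
    then show "continuous_map (subtopology ?X ({0..1} \<times> U i)) Z (h i)"
      using h[OF i] by simp
  next
    fix i j p assume "i \<in> I" "j \<in> I" "p \<in> topspace ?X \<inter> {0..1} \<times> U i \<inter> {0..1} \<times> U j"
    then have "snd p \<in> U i \<inter> U j" "i \<in> I" "j \<in> I" by auto
    then have "i = j" using disj by blast
    then show "h i p = h j p" by simp
  next
    fix p assume "p \<in> topspace ?X"
    then obtain i where "i \<in> I" "snd p \<in> U i" "fst p \<in> {0..1}" by auto
    then show "\<exists>j. j \<in> I \<and> p \<in> {0..1} \<times> U j \<and> H p = h j p"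
      using c[of i "snd p"] by (intro exI[of _ i]) (simp add: H_def mem_Times_iff)
  qed
  moreover have "H (0, x) = f x" "H (1, x) = g x" if x: "x \<in> topspace (subtopology Y (\<Union>i\<in>I. U i))" for x
  proof -
    obtain i where "i \<in> I" "x \<in> U i" using x by auto
    then show "H (0, x) = f x" "H (1, x) = g x" by (simp_all add: H_def c h0 h1)
  qed
  ultimately show ?thesis by (rule homotopic_with_TrueI)
qed

section \<open>Upper bound: categorical covers of moment angle complexes\<close>

context
  fixes V :: "'v set" and K :: "'v set set"
begin

private abbreviation (input) "Z \<equiv> moment_angle_complex V K"

lemma topspace_moment_angle_complex:
  "z \<in> topspace Z \<longleftrightarrow> z \<in> extensional V \<and> (\<forall>v\<in>V. norm (z v) \<le> 1) \<and>
    (\<exists>\<sigma>\<in>K. \<forall>v\<in>V - \<sigma>. norm (z v) = 1)" (is "?L \<longleftrightarrow> ?R")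
proof
  assume ?L
  then show ?R
    by (fastforce simp: moment_angle_complex_def PiE_iff split: if_splits)
next
  assume R: ?R
  then obtain \<sigma> where s: "\<sigma> \<in> K" "\<forall>v\<in>V - \<sigma>. norm (z v) = 1" by blast
  then have "z \<in> (\<Pi>\<^sub>E i\<in>V. if i \<in> \<sigma> then cball 0 1 else sphere 0 1)"
    using R by (auto simp: PiE_iff)
  then show ?L
    using R s(1) by (auto simp: moment_angle_complex_def PiE_iff)
qed

lemma continuous_map_into_moment_angle_complex:
  assumes "\<And>v. v \<in> V \<Longrightarrow> continuous_map X euclidean (\<lambda>x. f x v)"
    and "\<And>x. x \<in> topspace X \<Longrightarrow> f x \<in> topspace Z"
  shows "continuous_map X Z f"
proof -
  have "continuous_map X (product_topology (\<lambda>_. top_of_set (cball 0 1)) V) f"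
    unfolding continuous_map_componentwise
    using assms by (auto simp: topspace_moment_angle_complex continuous_map_in_subtopology)
  moreover have "f x \<in> (\<Union>\<sigma>\<in>K. \<Pi>\<^sub>E i\<in>V. if i \<in> \<sigma> then cball 0 1 else sphere 0 1)"
    if "x \<in> topspace X" for x
    using assms(2)[OF that] unfolding moment_angle_complex_def by simp
  ultimately show ?thesis
    unfolding moment_angle_complex_def by (auto simp: continuous_map_in_subtopology)
qed

lemma continuous_map_moment_angle_coordinate:
  assumes "v \<in> V"
  shows "continuous_map Z euclidean (\<lambda>z. z v)"
proof -
  have "continuous_map Z (top_of_set (cball 0 1)) (\<lambda>z. z v)"
    unfolding moment_angle_complex_def
    using assms by (intro continuous_map_from_subtopology continuous_map_product_projection)
  then show ?thesis by (simp add: continuous_map_in_subtopology)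
qed

text \<open>On the segment from \<open>f x\<close> to \<open>g x\<close> the coordinates outside
  \<sigma> stand still on the circle, and the others stay in the disc by convexity. So the segment
  remains in the block of \<sigma>, which may vary with \<open>x\<close>.\<close>

lemma homotopic_into_moment_angle_complex_linear:
  assumes f: "continuous_map X Z f" and g: "continuous_map X Z g"
    and fg: "\<And>x. x \<in> topspace X \<Longrightarrow> \<exists>\<sigma>\<in>K. \<forall>v\<in>V - \<sigma>. f x v = g x v \<and> norm (f x v) = 1"
  shows "homotopic_with (\<lambda>_. True) X Z f g"
proof -
  let ?X = "prod_topology (top_of_set {0..1::real}) X"
  define h where "h p = (\<lambda>v\<in>V. (1 - fst p) *\<^sub>R f (snd p) v + fst p *\<^sub>R g (snd p) v)"
    for p :: "real \<times> 'a"
  have fZ: "f x \<in> topspace Z" and gZ: "g x \<in> topspace Z" if "x \<in> topspace X" for x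
    using f g that by (auto dest: continuous_map_funspace)
  have "continuous_map ?X Z h"
  proof (rule continuous_map_into_moment_angle_complex)
    fix v assume v: "v \<in> V"
    have t: "continuous_map ?X euclidean fst"
      by (rule continuous_map_into_fulltopology[OF continuous_map_fst])
    have fv: "continuous_map ?X euclidean (\<lambda>p. f (snd p) v)"
      using continuous_map_compose[OF continuous_map_compose[OF continuous_map_snd f]
          continuous_map_moment_angle_coordinate[OF v]] by (simp add: o_def)
    have gv: "continuous_map ?X euclidean (\<lambda>p. g (snd p) v)"
      using continuous_map_compose[OF continuous_map_compose[OF continuous_map_snd g]
          continuous_map_moment_angle_coordinate[OF v]] by (simp add: o_def)
    have "continuous_map ?X euclidean (\<lambda>p. (1 - fst p) *\<^sub>R f (snd p) v + fst p *\<^sub>R g (snd p) v)"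
      by (intro continuous_map_add continuous_map_scaleR continuous_map_diff t fv gv) simp
    then show "continuous_map ?X euclidean (\<lambda>p. h p v)" using v by (simp add: h_def)
  next
    fix p assume p: "p \<in> topspace ?X"
    then have x: "snd p \<in> topspace X" and t: "0 \<le> fst p" "fst p \<le> 1" by auto
    obtain \<sigma> where s: "\<sigma> \<in> K" "\<And>v. v \<in> V - \<sigma> \<Longrightarrow> f (snd p) v = g (snd p) v \<and> norm (f (snd p) v) = 1"
      using fg[OF x] by blast
    have "norm (h p v) \<le> 1" if v: "v \<in> V" for v
    proof -
      have "f (snd p) v \<in> cball 0 1" "g (snd p) v \<in> cball 0 1"
        using v fZ[OF x] gZ[OF x] by (auto simp: topspace_moment_angle_complex)
      from convexD_alt[OF convex_cball this t] show ?thesis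
        using v by (simp add: h_def)
    qed
    moreover have "norm (h p v) = 1" if v: "v \<in> V - \<sigma>" for v
    proof -
      have "h p v = g (snd p) v" using s(2)[OF v] v by (simp add: h_def scaleR_left_diff_distrib)
      then show ?thesis using s(2)[OF v] by metis
    qed
    moreover have "h p \<in> extensional V" by (simp add: h_def)
    ultimately show "h p \<in> topspace Z"
      using s(1) by (auto simp: topspace_moment_angle_complex)
  qed
  moreover have "h (0, x) = f x" "h (1, x) = g x" if "x \<in> topspace X" for x
    using fZ[OF that] gZ[OF that] unfolding h_def topspace_moment_angle_complex
    by (simp_all add: extensional_restrict cong: restrict_cong)
  ultimately show ?thesis by (rule homotopic_with_TrueI)
qed

text \<open>The coordinates move to 1 one after another. While the coordinate \<open>v\<close>
  crosses its disc, all others lie on the circle, so the motion stays in the block of the simplex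
  \<open>{v}\<close>.\<close>

lemma homotopic_torus_into_moment_angle_complex:
  assumes fin: "finite V" and sing: "\<And>v. v \<in> V \<Longrightarrow> {v} \<in> K"
    and emp: "{} \<in> K"
    and f: "continuous_map X Z f" and f1: "\<And>x v. x \<in> topspace X \<Longrightarrow> v \<in> V \<Longrightarrow> norm (f x v) = 1"
  shows "homotopic_with (\<lambda>_. True) X Z f (\<lambda>_. \<lambda>v\<in>V. 1)"
proof -
  define F where "F S x = (\<lambda>v\<in>V. if v \<in> S then 1 else f x v)" for S x
  have F: "continuous_map X Z (F S)" for S
  proof (rule continuous_map_into_moment_angle_complex)
    fix v assume v: "v \<in> V"
    have "continuous_map X euclidean (\<lambda>x. f x v)"
      using continuous_map_compose[OF f continuous_map_moment_angle_coordinate[OF v]] by (simp add: o_def)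
    then show "continuous_map X euclidean (\<lambda>x. F S x v)" using v by (simp add: F_def)
  next
    fix x assume "x \<in> topspace X"
    then show "F S x \<in> topspace Z"
      using f1 emp by (auto simp: topspace_moment_angle_complex F_def)
  qed
  have "homotopic_with (\<lambda>_. True) X Z (F {}) (F S)" if "finite S" "S \<subseteq> V" for S
    using that
  proof (induction S rule: finite_induct)
    case empty
    then show ?case using F by simp
  next
    case (insert a S)
    have "homotopic_with (\<lambda>_. True) X Z (F S) (F (insert a S))"
    proof (rule homotopic_into_moment_angle_complex_linear[OF F F])
      fix x assume x: "x \<in> topspace X"
      show "\<exists>\<sigma>\<in>K. \<forall>v\<in>V - \<sigma>. F S x v = F (insert a S) x v \<and> norm (F S x v) = 1"
        using insert.prems x f1 by (intro bexI[of _ "{a}"] sing) (auto simp: F_def)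
    qed
    then show ?case using insert by (meson homotopic_with_trans insert_subset)
  qed
  from this[OF fin subset_refl] have "homotopic_with (\<lambda>_. True) X Z (F {}) (F V)" .
  moreover have "f x \<in> extensional V" if "x \<in> topspace X" for x
    using continuous_map_funspace[OF f] that topspace_moment_angle_complex by blast
  ultimately show ?thesis
    by (rule_tac homotopic_with_eq)
      (auto simp: F_def fun_eq_iff extensional_def restrict_def)
qed

text \<open>One open set per cardinality 0, ..., \<open>n\<close> of simplices. All its pieces
  contract to the same point, the one with every coordinate 1, so their disjoint union is
  contractible in the complex too.\<close>

lemma moment_angle_complex_categorical_cover:
  assumes fin: "finite V" and K: "\<And>\<sigma>. \<sigma> \<in> K \<Longrightarrow> \<sigma> \<subseteq> V" and emp: "{} \<in> K"
    and down: "\<And>\<sigma> \<tau>. \<sigma> \<in> K \<Longrightarrow> \<tau> \<subseteq> \<sigma> \<Longrightarrow> \<tau> \<in> K"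
    and sing: "\<And>v. v \<in> V \<Longrightarrow> {v} \<in> K"
    and card: "\<And>\<sigma>. \<sigma> \<in> K \<Longrightarrow> card \<sigma> \<le> n"
  shows "\<exists>U. (\<forall>i\<le>n. openin Z (U i) \<and> contractible_in Z (U i)) \<and> (\<Union>i\<le>n. U i) = topspace Z"
proof -
  \<comment> \<open>Open neighbourhoods of the strata of points whose interior coordinates are exactly those in \<open>\<sigma>\<close>.\<close>
  define W where "W \<sigma> = {z \<in> topspace Z. \<forall>w\<in>V - \<sigma>. z w \<noteq> 0 \<and> (\<forall>v\<in>\<sigma>. norm (z v) < norm (z w))}" for \<sigma>
  define U where "U i = (\<Union>\<sigma>\<in>{\<sigma> \<in> K. card \<sigma> = i}. W \<sigma>)" for i
  have coord: "continuous_map Z euclidean (\<lambda>z. z v)" if "v \<in> V" for v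
    using that by (rule continuous_map_moment_angle_coordinate)
  have opeW: "openin Z (W \<sigma>)" if "\<sigma> \<in> K" for \<sigma>
    unfolding W_def
  proof (rule openin_Collect_ball_finite)
    show "finite (V - \<sigma>)" using fin by simp
    fix w assume w: "w \<in> V - \<sigma>"
    have "openin Z {z \<in> topspace Z. z w \<in> - {0}}"
      using w by (intro openin_continuous_map_preimage[OF coord]) auto
    moreover have "openin Z {z \<in> topspace Z. \<forall>v\<in>\<sigma>. norm (z v) < norm (z w)}"
      using K[OF that] fin w
      by (intro openin_Collect_ball_finite openin_Collect_less continuous_map_norm coord)
        (auto intro: finite_subset)
    ultimately have "openin Z ({z \<in> topspace Z. z w \<in> - {0}} \<inter>
        {z \<in> topspace Z. \<forall>v\<in>\<sigma>. norm (z v) < norm (z w)})"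
      by (rule openin_Int)
    then show "openin Z {z \<in> topspace Z. z w \<noteq> 0 \<and> (\<forall>v\<in>\<sigma>. norm (z v) < norm (z w))}"
      by (rule back_subst[of "openin Z"]) auto
  qed
  have disj: "W \<sigma> \<inter> W \<tau> = {}" if st: "\<sigma> \<in> K" "\<tau> \<in> K" "card \<sigma> = card \<tau>" "\<sigma> \<noteq> \<tau>" for \<sigma> \<tau>
  proof -
    have fin': "finite \<sigma>" "finite \<tau>"
      using K[OF st(1)] K[OF st(2)] fin by (simp_all add: finite_subset)
    \<comment> \<open>Distinct finite sets of equal size are incomparable. An element from each
      difference then has to be strictly smaller in norm than the other on one neighbourhood, and
      strictly larger on the other.\<close>
    have "\<not> \<sigma> \<subseteq> \<tau>" "\<not> \<tau> \<subseteq> \<sigma>"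
      using card_subset_eq[OF fin'(1), of \<tau>] card_subset_eq[OF fin'(2), of \<sigma>] st(3,4) by auto
    then obtain a b where ab: "a \<in> \<sigma> - \<tau>" "b \<in> \<tau> - \<sigma>" by blast
    then have "a \<in> V - \<tau>" "b \<in> V - \<sigma>" using K st(1,2) by auto
    have "norm (z a) < norm (z b)" if "z \<in> W \<sigma>" for z
      using that ab \<open>b \<in> V - \<sigma>\<close> unfolding W_def by blast
    moreover have "norm (z b) < norm (z a)" if "z \<in> W \<tau>" for z
      using that ab \<open>a \<in> V - \<tau>\<close> unfolding W_def by blast
    ultimately show ?thesis by (meson disjoint_iff less_asym)
  qed
  have hom: "homotopic_with (\<lambda>_. True) (subtopology Z (W \<sigma>)) Z id (\<lambda>_. \<lambda>v\<in>V. 1)"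
    if s: "\<sigma> \<in> K" for \<sigma>
  proof -
    let ?X = "subtopology Z (W \<sigma>)"
    have XW: "x \<in> topspace Z" "x \<in> W \<sigma>" if "x \<in> topspace ?X" for x
      using that by auto
    \<comment> \<open>Push the coordinates outside \<open>\<sigma>\<close> radially to the circle, then those in \<open>\<sigma>\<close> to 1; this ends in the torus.\<close>
    define g1 where "g1 z = (\<lambda>v\<in>V. if v \<in> \<sigma> then z v else inverse (norm (z v)) *\<^sub>R z v)" for z :: "'v \<Rightarrow> complex"
    define g2 where "g2 z = (\<lambda>v\<in>V. if v \<in> \<sigma> then 1 else inverse (norm (z v)) *\<^sub>R z v)" for z :: "'v \<Rightarrow> complex"
    \<comment> \<open>Normalising needs \<open>x v\<close> nonzero. For empty \<sigma> the norm
      comparisons in \<open>W \<sigma>\<close> are vacuous, and only the clause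
      \<open>z w \<noteq> 0\<close> provides this.\<close>
    have n1: "norm (inverse (norm (x v)) *\<^sub>R x v) = 1" if "x \<in> W \<sigma>" "v \<in> V - \<sigma>" for x v
      using that by (auto simp: W_def)
    have cX: "continuous_map ?X euclidean (\<lambda>z. z v)" if "v \<in> V" for v
      by (rule continuous_map_from_subtopology[OF coord[OF that]])
    have cinv: "continuous_map ?X euclidean (\<lambda>z. inverse (norm (z v)) *\<^sub>R z v)" if v: "v \<in> V - \<sigma>" for v
    proof (rule continuous_map_scaleR)
      have "continuous_map ?X euclideanreal (\<lambda>z. norm (z v))"
        using v by (intro continuous_map_norm cX) auto
      then show "continuous_map ?X euclideanreal (\<lambda>z. inverse (norm (z v)))"
        using v by (intro continuous_map_real_inverse) (auto simp: W_def)
    qed (use v cX in auto)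
    have id: "continuous_map ?X Z id" by (simp add: continuous_map_from_subtopology)
    have g1: "continuous_map ?X Z g1"
    proof (rule continuous_map_into_moment_angle_complex)
      fix v assume v: "v \<in> V"
      show "continuous_map ?X euclidean (\<lambda>x. g1 x v)"
        using v cX[of v] cinv[of v] by (cases "v \<in> \<sigma>") (simp_all add: g1_def)
    next
      fix x assume x: "x \<in> topspace ?X"
      note x = XW[OF x]
      then show "g1 x \<in> topspace Z"
        using n1[OF x(2)] s by (force simp: topspace_moment_angle_complex g1_def)
    qed
    have g2: "continuous_map ?X Z g2"
    proof (rule continuous_map_into_moment_angle_complex)
      fix v assume v: "v \<in> V"
      show "continuous_map ?X euclidean (\<lambda>x. g2 x v)"
        using v cinv[of v] by (cases "v \<in> \<sigma>") (simp_all add: g2_def)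
    next
      fix x assume x: "x \<in> topspace ?X"
      then show "g2 x \<in> topspace Z"
        using n1[OF XW(2)[OF x]] s by (force simp: topspace_moment_angle_complex g2_def)
    qed
    have "homotopic_with (\<lambda>_. True) ?X Z id g1"
    proof (rule homotopic_into_moment_angle_complex_linear[OF id g1])
      fix x assume "x \<in> topspace ?X"
      note x = XW[OF this]
      \<comment> \<open>The block used here is one that contains \<open>x\<close> itself, not that
        of \<sigma>: outside \<rho> the coordinates already have norm 1, so \<open>g1\<close> fixes
        them.\<close>
      then obtain \<rho> where "\<rho> \<in> K" "\<forall>v\<in>V - \<rho>. norm (x v) = 1"
        by (auto simp: topspace_moment_angle_complex)
      then show "\<exists>\<sigma>\<in>K. \<forall>v\<in>V - \<sigma>. id x v = g1 x v \<and> norm (id x v) = 1"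
        by (intro bexI[of _ \<rho>]) (auto simp: g1_def)
    qed
    moreover have "homotopic_with (\<lambda>_. True) ?X Z g1 g2"
    proof (rule homotopic_into_moment_angle_complex_linear[OF g1 g2])
      fix x assume "x \<in> topspace ?X"
      note x = XW[OF this]
      show "\<exists>\<sigma>\<in>K. \<forall>v\<in>V - \<sigma>. g1 x v = g2 x v \<and> norm (g1 x v) = 1"
        using s n1[OF x(2)] by (intro bexI[of _ \<sigma>]) (auto simp: g1_def g2_def)
    qed
    moreover have "homotopic_with (\<lambda>_. True) ?X Z g2 (\<lambda>_. \<lambda>v\<in>V. 1)"
    proof (rule homotopic_torus_into_moment_angle_complex[OF fin sing emp g2])
      fix x v assume "x \<in> topspace ?X" and v: "v \<in> V"
      note x = XW[OF this(1)]
      show "norm (g2 x v) = 1"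
        using v n1[OF x(2), of v] by (auto simp: g2_def)
    qed
    ultimately show ?thesis by (meson homotopic_with_trans)
  qed
  have "openin Z (U i)" for i
    unfolding U_def using opeW by (intro openin_Union) auto
  moreover have "contractible_in Z (U i)" for i
    unfolding contractible_in_def U_def
    by (rule exI, rule homotopic_with_disjoint_Union[OF opeW disj hom]) auto
  moreover have "(\<Union>i\<le>n. U i) = topspace Z"
  proof
    show "(\<Union>i\<le>n. U i) \<subseteq> topspace Z" by (auto simp: U_def W_def)
    show "topspace Z \<subseteq> (\<Union>i\<le>n. U i)"
    proof
      fix z assume z: "z \<in> topspace Z"
      \<comment> \<open>The stratum of \<open>z\<close>. It is a face of any simplex whose block
        contains \<open>z\<close>, and every norm outside it is 1, hence larger than those
        inside.\<close>
      define \<tau> where "\<tau> = {v \<in> V. norm (z v) < 1}"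
      obtain \<sigma> where "\<sigma> \<in> K" "\<forall>v\<in>V - \<sigma>. norm (z v) = 1"
        using z by (auto simp: topspace_moment_angle_complex)
      then have t: "\<tau> \<in> K" by (intro down[of \<sigma> \<tau>]) (force simp: \<tau>_def)+
      have "norm (z w) = 1" if "w \<in> V - \<tau>" for w
        using z that by (force simp: topspace_moment_angle_complex \<tau>_def)
      then have "z \<in> W \<tau>" using z by (force simp: W_def \<tau>_def)
      then show "z \<in> (\<Union>i\<le>n. U i)" using t card[OF t] by (auto simp: U_def)
    qed
  qed
  ultimately show ?thesis by blast
qed

end

section \<open>Lower bound: the hypersurface \<open>torus_shell\<close> and Borsuk's
  criterion\<close>

lemma bounded_vec_componentwise:
  "bounded {x :: 'a::real_normed_vector ^ 'n. \<forall>i. norm (x $ i) \<le> B}"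
proof (rule boundedI)
  fix x :: "'a ^ 'n" assume x: "x \<in> {x. \<forall>i. norm (x $ i) \<le> B}"
  have "norm x \<le> (\<Sum>i\<in>UNIV. norm (x $ i))"
    unfolding norm_vec_def by (rule L2_set_le_sum) simp
  also have "\<dots> \<le> (\<Sum>i\<in>(UNIV :: 'n set). B)"
    using x by (intro sum_mono) simp
  finally show "norm x \<le> (\<Sum>i\<in>(UNIV :: 'n set). B)" .
qed

text \<open>A closed hypersurface that fibres over the product of the unit spheres of the factors; the fibre
  is the boundary of a cube. It bounds the set of all points whose components have norm strictly
  between 1/2 and 3/2.\<close>

definition torus_shell :: "('a::real_normed_vector ^ 'n) set" where
  "torus_shell = {x. (\<forall>i. \<bar>norm (x $ i) - 1\<bar> \<le> 1/2) \<and> (\<exists>i. \<bar>norm (x $ i) - 1\<bar> = 1/2)}"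

lemma torus_shell_norm_pos: "x \<in> torus_shell \<Longrightarrow> 0 < norm (x $ i)"
proof -
  assume "x \<in> torus_shell"
  then have "\<bar>norm (x $ i) - 1\<bar> \<le> 1/2" by (simp add: torus_shell_def)
  then show ?thesis by linarith
qed

lemma compact_torus_shell: "compact (torus_shell :: ('a::euclidean_space ^ 'n) set)"
proof -
  let ?C = "torus_shell :: ('a ^ 'n) set"
  have "?C = {x. \<forall>i. \<bar>norm (x $ i) - 1\<bar> \<le> 1/2} \<inter> (\<Union>i. {x. \<bar>norm (x $ i) - 1\<bar> = 1/2})"
    by (auto simp: torus_shell_def)
  moreover have "closed \<dots>"
    by (intro closed_Int closed_Collect_all closed_UN closed_Collect_le closed_Collect_eq
        continuous_intros finite ballI)
  ultimately have "closed ?C" by simp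
  moreover have "bounded ?C"
  proof (rule bounded_subset[OF bounded_vec_componentwise])
    show "?C \<subseteq> {x. \<forall>i. norm (x $ i) \<le> 3/2}"
    proof clarify
      fix x :: "'a ^ 'n" and i assume "x \<in> torus_shell"
      then have "\<bar>norm (x $ i) - 1\<bar> \<le> 1/2" by (simp add: torus_shell_def)
      then show "norm (x $ i) \<le> 3/2" by linarith
    qed
  qed
  ultimately show ?thesis by (simp add: compact_eq_bounded_closed)
qed

text \<open>The complement of the shell splits into the disjoint open sets \<open>?I\<close> and
  \<open>?O\<close>. The component of \<open>q\<close> is connected and meets \<open>?I\<close>, so
  it stays within that bounded set.\<close>

lemma bounded_component_torus_shell:
  fixes q :: "'a::euclidean_space ^ 'n"
  assumes q: "\<And>i. norm (q $ i) = 1"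
  shows "bounded (connected_component_set (- torus_shell) q)"
proof -
  let ?D = "connected_component_set (- torus_shell) q"
  let ?I = "\<Inter>i. {x :: 'a ^ 'n. \<bar>norm (x $ i) - 1\<bar> < 1/2}"
  let ?O = "\<Union>i. {x :: 'a ^ 'n. 1/2 < \<bar>norm (x $ i) - 1\<bar>}"
  have opens: "open ?I" "open ?O"
    by (intro open_INT open_UN ballI open_Collect_less continuous_intros finite; simp)+
  have DIO: "?D \<subseteq> ?I \<union> ?O"
  proof
    fix x assume "x \<in> ?D"
    then have "x \<notin> torus_shell" using connected_component_subset by blast
    then have "(\<exists>i. 1/2 < \<bar>norm (x $ i) - 1\<bar>) \<or> (\<forall>i. \<bar>norm (x $ i) - 1\<bar> \<noteq> 1/2)"
      by (simp add: torus_shell_def not_le)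
    then show "x \<in> ?I \<union> ?O"
      by (metis (mono_tags, lifting) INT_I UN_I UNIV_I UnI1 UnI2 linorder_neqE_linordered_idom mem_Collect_eq)
  qed
  have IO: "?I \<inter> ?O = {}"
  proof (rule equals0I)
    fix x assume x: "x \<in> ?I \<inter> ?O"
    then obtain i where "1/2 < \<bar>norm (x $ i) - 1\<bar>" by blast
    moreover have "\<bar>norm (x $ i) - 1\<bar> < 1/2" using x by blast
    ultimately show False by linarith
  qed
  have "q \<in> ?I" using q by simp
  moreover have "q \<in> ?D"
  proof -
    have "q \<notin> torus_shell" using q by (simp add: torus_shell_def)
    then show ?thesis by simp
  qed
  ultimately have "?I \<inter> ?D \<noteq> {}" by blast
  moreover have "?I \<inter> ?O \<inter> ?D = {}" unfolding IO by simp
  ultimately have "?O \<inter> ?D = {}"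
    using connectedD[OF connected_connected_component opens _ DIO] by metis
  then have DI: "?D \<subseteq> ?I" using DIO by blast
  show ?thesis
  proof (rule bounded_subset[OF bounded_vec_componentwise])
    show "?D \<subseteq> {x. \<forall>i. norm (x $ i) \<le> 3/2}"
    proof (intro subsetI CollectI allI)
      fix x i assume "x \<in> ?D"
      then have "\<bar>norm (x $ i) - 1\<bar> < 1/2" using DI by blast
      then show "norm (x $ i) \<le> 3/2" by linarith
    qed
  qed
qed

text \<open>Replacing the direction of each component of \<open>x\<close> by \<open>g i x\<close>,
  with its norm kept, gives a self-map \<open>F\<close> of the shell homotopic to the identity. If
  the value \<open>q\<close> were omitted, the Borsuk map \<open>b\<close> of \<open>q\<close> would
  be null-homotopic on the image of \<open>F\<close>, hence on the shell, although \<open>q\<close>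
  lies in a bounded component of the complement.\<close>

lemma torus_shell_perturbed_projections_surj:
  fixes q :: "'a::euclidean_space ^ 'n" and g :: "'n \<Rightarrow> 'a ^ 'n \<Rightarrow> 'a"
  assumes q: "\<And>i. norm (q $ i) = 1"
    and hom: "\<And>i. homotopic_with_canon (\<lambda>_. True) torus_shell (sphere 0 1) (\<lambda>x. x $ i /\<^sub>R norm (x $ i)) (g i)"
  shows "\<exists>x\<in>torus_shell. \<forall>i. g i x = q $ i"
proof (rule ccontr)
  assume contra: "\<not> ?thesis"
  let ?C = "torus_shell :: ('a ^ 'n) set"
  define b where "b x = inverse (norm (x - q)) *\<^sub>R (x - q)" for x
  define F where "F x = (\<chi> i. norm (x $ i) *\<^sub>R g i x)" for x
  obtain h where h: "\<And>i. continuous_on ({0..1::real} \<times> ?C) (h i)"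
    and hS: "\<And>i p. p \<in> {0..1} \<times> ?C \<Longrightarrow> norm (h i p) = 1"
    and h0: "\<And>i x. h i (0, x) = x $ i /\<^sub>R norm (x $ i)" and h1: "\<And>i x. h i (1, x) = g i x"
  proof -
    have "\<forall>i. \<exists>h. continuous_on ({0..1::real} \<times> ?C) h \<and> h ` ({0..1} \<times> ?C) \<subseteq> sphere 0 1 \<and>
        (\<forall>x. h (0, x) = x $ i /\<^sub>R norm (x $ i)) \<and> (\<forall>x. h (1, x) = g i x)"
      using hom unfolding homotopic_with_def
      by (simp add: image_subset_iff_funcset)
    then obtain h where *: "\<And>i. continuous_on ({0..1::real} \<times> ?C) (h i) \<and> h i ` ({0..1} \<times> ?C) \<subseteq> sphere 0 1 \<and>
        (\<forall>x. h i (0, x) = x $ i /\<^sub>R norm (x $ i)) \<and> (\<forall>x. h i (1, x) = g i x)"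
      by metis
    show ?thesis
      by (rule that[of h]) (use * in \<open>force simp: image_subset_iff\<close>)+
  qed
  \<comment> \<open>Membership in the shell depends only on the norms of the components, which
    \<open>H\<close> preserves.\<close>
  define H where "H p = (\<chi> i. norm (snd p $ i) *\<^sub>R h i p)" for p
  have homF: "homotopic_with_canon (\<lambda>_. True) ?C ?C id F"
  proof (rule homotopic_with_TrueI[where h = H])
    have "continuous_on ({0..1} \<times> ?C) H"
      unfolding H_def by (intro continuous_intros h)
    moreover have "H p \<in> ?C" if p: "p \<in> {0..1} \<times> ?C" for p
    proof -
      have "norm (H p $ i) = norm (snd p $ i)" for i
        using hS[OF p, of i] by (simp add: H_def)
      then show ?thesis using p by (auto simp: torus_shell_def)
    qed
    ultimately show "continuous_map (prod_topology (top_of_set {0..1}) (top_of_set ?C)) (top_of_set ?C) H"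
      by auto
  next
    fix x assume "x \<in> topspace (top_of_set ?C)"
    then have "norm (x $ i) \<noteq> 0" for i
      using torus_shell_norm_pos[of x i] by simp
    then show "H (0, x) = id x" by (simp add: H_def h0 vec_eq_iff)
  qed (simp add: H_def F_def h1)
  then have contF: "continuous_on ?C F" and FC: "F ` ?C \<subseteq> ?C"
    using homotopic_with_imp_continuous homotopic_with_imp_subset2 by blast+
  have qC: "q \<notin> ?C" using q by (simp add: torus_shell_def)
  have gS: "norm (g i x) = 1" if "x \<in> ?C" for i x
    using homotopic_with_imp_subset2[OF hom[of i]] that by auto
  let ?S = "F ` ?C"
  have compS: "compact ?S" using contF compact_torus_shell by (rule compact_continuous_image)
  have qS: "q \<notin> ?S" using FC qC by blast
  \<comment> \<open>Since \<open>F\<close> omits the direction of \<open>q\<close>, the image of \<open>F\<close> no longer separates \<open>q\<close> from infinity.\<close>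
  let ?R = "(\<lambda>s. s *\<^sub>R q) ` {1..}"
  have "?R \<subseteq> - ?S"
  proof clarify
    fix s :: real and x assume s: "1 \<le> s" and x: "x \<in> ?C" and eq: "s *\<^sub>R q = F x"
    have eqi: "s *\<^sub>R q $ i = norm (x $ i) *\<^sub>R g i x" for i
      using arg_cong[OF eq, of "\<lambda>y. y $ i"] by (simp add: F_def)
    \<comment> \<open>Both \<open>q $ i\<close> and \<open>g i x\<close> are unit vectors, so norms
      identify the two factors, which then cancel in every component.\<close>
    have "norm (x $ i) = s" for i
      using arg_cong[OF eqi[of i], of norm] s q gS[OF x] by simp
    then have "g i x = q $ i" for i
      using eqi[of i] s by simp
    then show False using contra x by blast
  qed
  moreover have "connected ?R" by (intro connected_continuous_image continuous_intros) simp
  moreover have "q \<in> ?R" by force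
  ultimately have "?R \<subseteq> connected_component_set (- ?S) q"
    by (intro connected_component_maximal)
  moreover have "\<not> bounded ?R"
  proof
    assume "bounded ?R"
    then obtain B where B: "\<And>y. y \<in> ?R \<Longrightarrow> norm y \<le> B"
      unfolding bounded_iff by blast
    \<comment> \<open>\<open>undefined\<close> stands for an arbitrary index: one component of norm
      1 bounds the norm of \<open>q\<close> from below.\<close>
    have nq: "1 \<le> norm q"
      using q Finite_Cartesian_Product.norm_nth_le[of q undefined] by simp
    have "norm ((\<bar>B\<bar> + 1) *\<^sub>R q) \<le> B" by (intro B imageI) simp
    moreover have "\<bar>B\<bar> + 1 \<le> (\<bar>B\<bar> + 1) * norm q" using nq by (simp add: mult_le_cancel_left1)
    ultimately show False by simp
  qed
  ultimately have "\<not> bounded (connected_component_set (- ?S) q)"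
    using bounded_subset by blast
  then obtain c where "homotopic_with_canon (\<lambda>_. True) ?S (sphere 0 1) b (\<lambda>_. c)"
    using Borsuk_map_essential_bounded_component[OF compS qS] unfolding b_def by blast
  then have "homotopic_with_canon (\<lambda>_. True) ?C (sphere 0 1) (b \<circ> F) ((\<lambda>_. c) \<circ> F)"
    by (rule homotopic_with_compose_continuous_right[OF _ contF]) auto
  \<comment> \<open>The homotopy from the identity to \<open>F\<close> runs inside the shell, so it
    avoids \<open>q\<close> and can be followed by \<open>b\<close>.\<close>
  moreover have "homotopic_with_canon (\<lambda>_. True) ?C (sphere 0 1) (b \<circ> id) (b \<circ> F)"
  proof (rule homotopic_with_compose_continuous_left[OF homF])
    have ne: "x - q \<noteq> 0" if "x \<in> ?C" for x using that qC by auto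
    then show "continuous_on ?C b" unfolding b_def by (intro continuous_intros) auto
    show "b \<in> ?C \<rightarrow> sphere 0 1" using ne by (auto simp: b_def)
  qed
  ultimately have "homotopic_with_canon (\<lambda>_. True) ?C (sphere 0 1) (b \<circ> id) ((\<lambda>_. c) \<circ> F)"
    using homotopic_with_trans by blast
  then have "homotopic_with_canon (\<lambda>_. True) ?C (sphere 0 1) b (\<lambda>_. c)"
    by (simp add: o_def)
  then show False
    using Borsuk_map_essential_bounded_component[OF compact_torus_shell qC]
      bounded_component_torus_shell[OF q] unfolding b_def by blast
qed

text \<open>Homotopy extension needs closed sets. With a Lebesgue number \<delta>, the points of
  \<open>S\<close> at distance at least \<delta>/3 from \<open>S - U i\<close> still cover: a ball
  of radius \<delta>/3 has diameter at most 2\<delta>/3 < \<delta>, so its trace on \<open>S\<close>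
  lies in some \<open>U i\<close>.\<close>

lemma compact_shrink_open_cover:
  fixes S :: "'a::metric_space set"
  assumes S: "compact S" and ope: "\<And>i. i \<in> I \<Longrightarrow> openin (top_of_set S) (U i)" and cov: "S \<subseteq> (\<Union>i\<in>I. U i)"
  obtains A where "\<And>i. i \<in> I \<Longrightarrow> closedin (top_of_set S) (A i)" "\<And>i. i \<in> I \<Longrightarrow> A i \<subseteq> U i" "S \<subseteq> (\<Union>i\<in>I. A i)"
proof (cases "I = {}")
  case True
  then show ?thesis using that cov by simp
next
  case False
  have "\<forall>i\<in>I. \<exists>T. open T \<and> U i = S \<inter> T"
    using ope by (simp add: openin_open)
  then obtain T where T: "\<And>i. i \<in> I \<Longrightarrow> open (T i) \<and> U i = S \<inter> T i"
    by metis
  obtain \<delta> where "0 < \<delta>" and \<delta>: "\<And>R. R \<subseteq> S \<Longrightarrow> diameter R < \<delta> \<Longrightarrow> \<exists>B\<in>T ` I. R \<subseteq> B"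
  proof (rule Lebesgue_number_lemma[OF S, of "T ` I"])
    show "S \<subseteq> \<Union> (T ` I)" using cov T by blast
  qed (use False T in auto)
  define A where "A i = S \<inter> (\<Inter>y\<in>S - U i. {x. \<delta> / 3 \<le> dist x y})" for i
  show ?thesis
  proof (rule that[of A])
    show "closedin (top_of_set S) (A i)" for i
      unfolding A_def
      by (intro closedin_closed_Int closed_INT ballI closed_Collect_le continuous_intros)
    show "A i \<subseteq> U i" for i
    proof
      fix x assume x: "x \<in> A i"
      show "x \<in> U i"
      proof (rule ccontr)
        assume "x \<notin> U i"
        then have "\<delta> / 3 \<le> dist x x" using x unfolding A_def by blast
        then show False using \<open>0 < \<delta>\<close> by simp
      qed
    qed
    show "S \<subseteq> (\<Union>i\<in>I. A i)"
    proof
      fix x assume x: "x \<in> S"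
      let ?R = "S \<inter> ball x (\<delta> / 3)"
      have "diameter ?R \<le> diameter (ball x (\<delta> / 3))"
        by (intro diameter_subset) auto
      also have "\<dots> \<le> 2 * (\<delta> / 3)"
      proof -
        have "dist y z \<le> 2 * (\<delta> / 3)" if "y \<in> ball x (\<delta> / 3)" "z \<in> ball x (\<delta> / 3)" for y z
          using dist_triangle3[of y z x] that by simp
        then have "(SUP (y, z)\<in>ball x (\<delta> / 3) \<times> ball x (\<delta> / 3). dist y z) \<le> 2 * (\<delta> / 3)"
          using \<open>0 < \<delta>\<close> by (intro cSUP_least) auto
        then show ?thesis using \<open>0 < \<delta>\<close> by (simp add: diameter_def)
      qed
      also have "\<dots> < \<delta>" using \<open>0 < \<delta>\<close> by simp
      finally obtain i where i: "i \<in> I" "?R \<subseteq> T i" using \<delta>[of ?R] by auto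
      then have "?R \<subseteq> U i" using T by blast
      then have "x \<in> A i" using x unfolding A_def by (auto simp: not_less)
      then show "x \<in> (\<Union>i\<in>I. A i)" using i by blast
    qed
  qed
qed

text \<open>There is one set per factor. Homotopy extension deforms the normalised i-th projection
  to a map \<open>g i\<close> with constant value \<open>c i\<close> on the shrunken set
  \<open>A i\<close>. The \<open>g i\<close> jointly attain the antipodes of all these constants at
  some point, which then lies in no \<open>A i\<close>.\<close>

lemma torus_shell_not_covered:
  fixes U :: "'n \<Rightarrow> ('a::euclidean_space ^ 'n) set"
  assumes ope: "\<And>i. openin (top_of_set torus_shell) (U i)" and cov: "torus_shell \<subseteq> (\<Union>i. U i)"
    and null: "\<And>i. \<exists>c. homotopic_with_canon (\<lambda>_. True) (U i) (sphere 0 1) (\<lambda>x. x $ i /\<^sub>R norm (x $ i)) (\<lambda>_. c)"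
  shows False
proof -
  let ?C = "torus_shell :: ('a ^ 'n) set"
  obtain A where cloA: "\<And>i. closedin (top_of_set ?C) (A i)" and AU: "\<And>i. A i \<subseteq> U i"
    and covA: "?C \<subseteq> (\<Union>i. A i)"
    using compact_shrink_open_cover[OF compact_torus_shell ope cov] by (metis UNIV_I)
  have "\<exists>g c. homotopic_with_canon (\<lambda>_. True) ?C (sphere 0 1) (\<lambda>x. x $ i /\<^sub>R norm (x $ i)) g \<and>
      (\<forall>x\<in>A i. g x = c)" for i
  proof -
    let ?f = "\<lambda>x :: 'a ^ 'n. x $ i /\<^sub>R norm (x $ i)"
    have nz: "x $ i \<noteq> 0" if "x \<in> ?C" for x using torus_shell_norm_pos[OF that, of i] by auto
    obtain c where "homotopic_with_canon (\<lambda>_. True) (U i) (sphere 0 1) ?f (\<lambda>_. c)"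
      using null by blast
    then have hom: "homotopic_with_canon (\<lambda>_. True) (A i) (sphere 0 1) ?f (\<lambda>_. c)"
      using AU by (rule homotopic_with_subset_left)
    have "continuous_on ?C ?f"
      by (intro continuous_intros) (use nz in auto)
    moreover have "?f \<in> ?C \<rightarrow> sphere 0 1" using nz by auto
    ultimately obtain g where "homotopic_with_canon (\<lambda>_. True) ?C (sphere 0 1) ?f g"
      "\<And>x. x \<in> A i \<Longrightarrow> g x = c"
      by (rule Borsuk_homotopy_extension_homotopic[OF cloA disjI2[OF ANR_sphere] _ _ hom]) blast
    then show ?thesis by blast
  qed
  then have "\<forall>i. \<exists>g c. homotopic_with_canon (\<lambda>_. True) ?C (sphere 0 1) (\<lambda>x. x $ i /\<^sub>R norm (x $ i)) g \<and>
      (\<forall>x\<in>A i. g x = c)" by blast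
  from choice[OF this] obtain g where "\<forall>i. \<exists>c.
      homotopic_with_canon (\<lambda>_. True) ?C (sphere 0 1) (\<lambda>x. x $ i /\<^sub>R norm (x $ i)) (g i) \<and>
      (\<forall>x\<in>A i. g i x = c)" ..
  from choice[OF this] obtain c where
    hom: "\<And>i. homotopic_with_canon (\<lambda>_. True) ?C (sphere 0 1) (\<lambda>x. x $ i /\<^sub>R norm (x $ i)) (g i)"
    and gc: "\<And>i x. x \<in> A i \<Longrightarrow> g i x = c i" by blast
  have gS: "norm (g i x) = 1" if "x \<in> ?C" for i x
    using homotopic_with_imp_subset2[OF hom[of i]] that by auto
  obtain e :: 'a where e: "norm e = 1" using vector_choose_size[of 1] by auto
  \<comment> \<open>If \<open>A i\<close> is empty, nothing is known about \<open>c i\<close>, so an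
    arbitrary unit vector replaces its antipode.\<close>
  define q :: "'a ^ 'n" where "q = (\<chi> i. if A i = {} then e else - c i)"
  have "norm (q $ i) = 1" for i
  proof (cases "A i = {}")
    case False
    then obtain x where "x \<in> A i" by blast
    then show ?thesis
      using gS[of x i] gc[of x i] closedin_imp_subset[OF cloA[of i]] by (auto simp: q_def)
  qed (simp add: q_def e)
  from torus_shell_perturbed_projections_surj[OF this hom]
  obtain x where x: "x \<in> ?C" "\<And>i. g i x = q $ i" by blast
  then obtain i where i: "x \<in> A i" using covA by blast
  then have "c i = - c i" using x(2)[of i] gc[OF i] i by (auto simp: q_def split: if_splits)
  then have "c i + c i = 0" by (rule eq_neg_iff_add_eq_0[THEN iffD1])
  then have "2 *\<^sub>R c i = 0" by (simp only: scaleR_2)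
  then have "c i = 0" by simp
  then show False using gS[OF x(1), of i] gc[OF i] by simp
qed

section \<open>Lower bound: passing from the complex to a product of 3-spheres\<close>

text \<open>The full subcomplex on the vertices \<open>a i\<close>, \<open>b i\<close> is the boundary of a cross-polytope, i.e. a join of
  copies of the 0-sphere, and its moment angle complex is a product of 3-spheres.\<close>

lemma moment_angle_complex_no_small_cover:
  fixes a b :: "'n::finite \<Rightarrow> 'v"
  assumes ab: "\<And>i. a i \<in> V" "\<And>i. b i \<in> V" and inj: "inj a" "inj b" "range a \<inter> range b = {}"
    and nonedge: "\<And>i \<sigma>. \<sigma> \<in> K \<Longrightarrow> a i \<in> \<sigma> \<Longrightarrow> b i \<notin> \<sigma>"
    and cross: "\<And>\<sigma>. \<sigma> \<subseteq> range a \<union> range b \<Longrightarrow> (\<And>i. a i \<in> \<sigma> \<Longrightarrow> b i \<notin> \<sigma>) \<Longrightarrow> \<sigma> \<in> K"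
    and U: "\<And>i. i \<le> k \<Longrightarrow> openin (moment_angle_complex V K) (U i)"
      "\<And>i. i \<le> k \<Longrightarrow> contractible_in (moment_angle_complex V K) (U i)"
      "(\<Union>i\<le>k. U i) = topspace (moment_angle_complex V K)"
  shows "CARD('n) \<le> k"
proof (rule ccontr)
  assume "\<not> CARD('n) \<le> k"
  then have k: "k < CARD('n)" by simp
  let ?Z = "moment_angle_complex V K"
  let ?C = "torus_shell :: ((complex \<times> complex) ^ 'n) set"
  \<comment> \<open>Division by this maximum norm carries a nonzero pair to the boundary of the
    bidisc, a 3-sphere on which at least one coordinate lies on the circle.\<close>
  define m where "m y = max (norm (fst y)) (norm (snd y))" for y :: "complex \<times> complex"
  have m_pos: "0 < m (x $ i)" if "x \<in> ?C" for x i
    using torus_shell_norm_pos[OF that, of i]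
    by (auto simp: m_def less_max_iff_disj prod_eq_iff)
  have m_le: "norm (fst y) \<le> m y" "norm (snd y) \<le> m y" for y by (auto simp: m_def)
  have m_eq: "norm (fst y) = m y \<or> norm (snd y) = m y" for y by (auto simp: m_def max_def)
  \<comment> \<open>The shell maps to the product of these 3-spheres inside the complex. Vertices
    outside both ranges get the coordinate 1, so they never enter the simplex.\<close>
  define J where "J x = (\<lambda>v\<in>V. if v \<in> range a then fst (x $ inv_into UNIV a v) /\<^sub>R m (x $ inv_into UNIV a v)
      else if v \<in> range b then snd (x $ inv_into UNIV b v) /\<^sub>R m (x $ inv_into UNIV b v) else 1)"
    for x :: "(complex \<times> complex) ^ 'n"
  have Ja: "J x (a i) = fst (x $ i) /\<^sub>R m (x $ i)" for x i
    using ab inj by (simp add: J_def)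
  have Jb: "J x (b i) = snd (x $ i) /\<^sub>R m (x $ i)" for x i
  proof -
    have "b i \<notin> range a" using inj(3) by blast
    then show ?thesis using ab inj by (simp add: J_def)
  qed
  have J1: "J x v = 1" if "v \<in> V" "v \<notin> range a" "v \<notin> range b" for x v
    using that by (simp add: J_def)
  have J: "continuous_map (top_of_set ?C) ?Z J"
  proof (rule continuous_map_into_moment_angle_complex)
    fix v assume v: "v \<in> V"
    have "continuous_on ?C (\<lambda>x. fst (x $ i) /\<^sub>R m (x $ i))"
         "continuous_on ?C (\<lambda>x. snd (x $ i) /\<^sub>R m (x $ i))" for i
      using m_pos[of _ i] unfolding m_def by (intro continuous_intros; force)+
    then have "continuous_on ?C (\<lambda>x. J x v)"
      using Ja Jb J1[OF v] by (cases "v \<in> range a"; cases "v \<in> range b") auto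
    then show "continuous_map (top_of_set ?C) euclidean (\<lambda>x. J x v)" by simp
  next
    fix x assume "x \<in> topspace (top_of_set ?C)"
    then have x: "x \<in> ?C" by simp
    define \<sigma> where "\<sigma> = {v \<in> range a \<union> range b. norm (J x v) \<noteq> 1}"
    have norm_a: "norm (J x (a i)) = norm (fst (x $ i)) / m (x $ i)"
      and norm_b: "norm (J x (b i)) = norm (snd (x $ i)) / m (x $ i)" for i
      using m_pos[OF x, of i] by (simp_all add: Ja Jb divide_inverse mult.commute)
    have "\<sigma> \<in> K"
    proof (rule cross)
      fix i assume "a i \<in> \<sigma>"
      then have "norm (snd (x $ i)) = m (x $ i)"
        using m_eq[of "x $ i"] m_pos[OF x, of i] by (auto simp: \<sigma>_def norm_a)
      then show "b i \<notin> \<sigma>" using m_pos[OF x, of i] by (simp add: \<sigma>_def norm_b)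
    qed (auto simp: \<sigma>_def)
    moreover have "norm (J x v) \<le> 1" if "v \<in> V" for v
    proof -
      have "norm (J x (a i)) \<le> 1" "norm (J x (b i)) \<le> 1" for i
        using m_le[of "x $ i"] m_pos[OF x, of i] by (simp_all add: norm_a norm_b)
      then show ?thesis using J1[OF that] by (cases "v \<in> range a"; cases "v \<in> range b") auto
    qed
    moreover have "norm (J x v) = 1" if "v \<in> V - \<sigma>" for v
      using that J1[of v x] by (cases "v \<in> range a"; cases "v \<in> range b") (auto simp: \<sigma>_def)
    moreover have "J x \<in> extensional V" by (simp add: J_def)
    ultimately show "J x \<in> topspace ?Z" by (auto simp: topspace_moment_angle_complex)
  qed
  \<comment> \<open>The retraction onto the i-th 3-sphere, now the round one. It is defined on the
    whole complex because \<open>a i\<close> and \<open>b i\<close> share no simplex, so one of the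
    two coordinates has norm 1.\<close>
  define r where "r i z = (z (a i), z (b i)) /\<^sub>R norm (z (a i), z (b i))" for i and z :: "'v \<Rightarrow> complex"
  have r: "continuous_map ?Z (top_of_set (sphere 0 1)) (r i)" for i
  proof -
    have nz: "(z (a i), z (b i)) \<noteq> 0" if z: "z \<in> topspace ?Z" for z
    proof -
      obtain \<sigma> where s: "\<sigma> \<in> K" "\<forall>v\<in>V - \<sigma>. norm (z v) = 1"
        using z by (auto simp: topspace_moment_angle_complex)
      have "a i \<notin> \<sigma> \<or> b i \<notin> \<sigma>" using nonedge[OF s(1)] by blast
      then have "norm (z (a i)) = 1 \<or> norm (z (b i)) = 1" using s(2) ab by blast
      then show ?thesis by (auto simp: zero_prod_def)
    qed
    have c: "continuous_map ?Z euclidean (\<lambda>z. (z (a i), z (b i)))"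
      using continuous_map_pairedI[OF continuous_map_moment_angle_coordinate[OF ab(1)]
          continuous_map_moment_angle_coordinate[OF ab(2)]] by simp
    have "continuous_map ?Z euclidean (r i)"
      unfolding r_def using nz
      by (intro continuous_map_scaleR continuous_map_real_inverse continuous_map_norm c) auto
    moreover have "r i z \<in> sphere 0 1" if "z \<in> topspace ?Z" for z
      using nz[OF that] by (simp add: r_def del: scaleR_Pair)
    ultimately show ?thesis by (auto simp: continuous_map_in_subtopology)
  qed
  have rJ: "r i (J x) = x $ i /\<^sub>R norm (x $ i)" if "x \<in> ?C" for x i
  proof -
    have "(J x (a i), J x (b i)) = x $ i /\<^sub>R m (x $ i)"
      by (simp add: Ja Jb prod_eq_iff)
    then show ?thesis using m_pos[OF that, of i] by (simp add: r_def)
  qed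
  obtain e :: "'n \<Rightarrow> nat" where e: "bij_betw e UNIV {..<CARD('n)}"
    using ex_bij_betw_finite_nat[of "UNIV :: 'n set"] by (auto simp: atLeast0LessThan)
  \<comment> \<open>The indices 0, ..., \<open>k\<close> are fewer than or equal in number to the
    factors; \<open>min\<close> repeats \<open>U k\<close> for the surplus ones, so that each factor
    receives a set.\<close>
  define W where "W i = {x \<in> ?C. J x \<in> U (min k (e i))}" for i
  show False
  proof (rule torus_shell_not_covered[of W])
    fix i
    have k': "min k (e i) \<le> k" by simp
    show "openin (top_of_set ?C) (W i)"
      using openin_continuous_map_preimage[OF J U(1)[OF k']] by (simp add: W_def)
    obtain z where z: "homotopic_with (\<lambda>_. True) (subtopology ?Z (U (min k (e i)))) ?Z id (\<lambda>_. z)"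
      using U(2)[OF k'] unfolding contractible_in_def by blast
    have "continuous_map (top_of_set (W i)) (subtopology ?Z (U (min k (e i)))) J"
      using continuous_map_from_subtopology_mono[OF J, of "W i"] 
      by (auto simp: W_def continuous_map_in_subtopology)
    from homotopic_with_compose_continuous_map_right[OF
      homotopic_with_compose_continuous_map_left[OF z r[of i], where q = "\<lambda>_. True"] this, where q = "\<lambda>_. True"]
    have "homotopic_with_canon (\<lambda>_. True) (W i) (sphere 0 1) (r i \<circ> id \<circ> J) (\<lambda>_. r i z)"
      by (simp add: o_def)
    then have "homotopic_with_canon (\<lambda>_. True) (W i) (sphere 0 1) (\<lambda>x. x $ i /\<^sub>R norm (x $ i)) (\<lambda>_. r i z)"
      by (rule homotopic_with_eq) (auto simp: W_def rJ)
    then show "\<exists>c. homotopic_with_canon (\<lambda>_. True) (W i) (sphere 0 1) (\<lambda>x. x $ i /\<^sub>R norm (x $ i)) (\<lambda>_. c)"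
      by blast
  next
    show "?C \<subseteq> (\<Union>i. W i)"
    proof
      fix x assume x: "x \<in> ?C"
      then have "J x \<in> topspace ?Z" using continuous_map_funspace[OF J] by auto
      then obtain j where j: "j \<le> k" "J x \<in> U j" using U(3) by blast
      then obtain i where "e i = j"
        using e k unfolding bij_betw_def by (metis imageE lessThan_iff order_le_less_trans)
      then have "x \<in> W i" using j x by (simp add: W_def min_absorb2)
      then show "x \<in> (\<Union>i. W i)" by blast
    qed
  qed
qed

section \<open>Independence of axis vectors and the complex over a prime field\<close>

text \<open>Vectors on one axis are multiples of \<open>axis i 1\<close>. This makes the two chosen
  vertices on each axis a non-edge.\<close>

lemma independent_axis_scalar_unique:
  fixes \<sigma> :: "('k::field ^ 'n) set"
  assumes ind: "vec.independent \<sigma>" and mem: "axis i 1 \<in> \<sigma>" "axis i c \<in> \<sigma>"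
  shows "c = 1"
proof (rule ccontr)
  assume "c \<noteq> 1"
  then have ne: "axis i c \<noteq> (axis i 1 :: 'k ^ 'n)" by (simp add: axis_eq_axis)
  have "axis i c = c *s (axis i 1 :: 'k ^ 'n)" by (simp add: vec_eq_iff axis_def)
  then have "axis i c \<in> vec.span (\<sigma> - {axis i c})"
    using ne mem by (metis Diff_iff singletonD vec.span_base vec.span_scale)
  then show False using ind mem(2) unfolding vec.dependent_def by blast
qed

text \<open>At most one member is supported on a given axis, so the i-th coordinate of a vanishing
  combination isolates its coefficient. This yields all faces of the cross-polytope.\<close>

lemma independent_axes:
  fixes \<sigma> :: "('k::field ^ 'n) set"
  assumes sub: "\<And>v. v \<in> \<sigma> \<Longrightarrow> \<exists>i c. c \<noteq> 0 \<and> v = axis i c"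
    and uniq: "\<And>i c d. axis i c \<in> \<sigma> \<Longrightarrow> axis i d \<in> \<sigma> \<Longrightarrow> c = d" and fin: "finite \<sigma>"
  shows "vec.independent \<sigma>"
proof (rule vec.independent_if_scalars_zero[OF fin])
  fix f v assume sum: "(\<Sum>x\<in>\<sigma>. f x *s x) = 0" and v: "v \<in> \<sigma>"
  obtain i c where c: "c \<noteq> 0" "v = axis i c" using sub[OF v] by blast
  have "x $ i = 0" if x: "x \<in> \<sigma>" "x \<noteq> v" for x
  proof -
    obtain j d where d: "x = axis j d" using sub[OF x(1)] by blast
    then have "j \<noteq> i" using x v c uniq by blast
    then show ?thesis using d by (simp add: axis_def)
  qed
  then have "(\<Sum>x\<in>\<sigma>. f x * x $ i) = (\<Sum>x\<in>\<sigma>. if x = v then f v * v $ i else 0)"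
    by (intro sum.cong) auto
  also have "\<dots> = f v * c" using fin v c by (simp add: axis_def)
  finally have "f v * c = (\<Sum>x\<in>\<sigma>. f x *s x) $ i" by simp
  then show "f v = 0" using sum c(1) by simp
qed

theorem theorem4p3:
  assumes "CARD('p::prime_card) > 2"
  shows "LS_category (moment_angle_complex
           (nonzero_vectors :: ('p mod_ring ^ 'n) set) independence_complex) = enat CARD('n)"
proof -
  let ?V = "nonzero_vectors :: ('p mod_ring ^ 'n) set"
  let ?K = "independence_complex :: ('p mod_ring ^ 'n) set set"
  let ?Z = "moment_angle_complex ?V ?K"
  let ?cov = "\<lambda>k. \<exists>U :: nat \<Rightarrow> (('p mod_ring ^ 'n) \<Rightarrow> complex) set.
     (\<forall>i\<le>k. openin ?Z (U i) \<and> contractible_in ?Z (U i)) \<and> (\<Union>i\<le>k. U i) = topspace ?Z"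
  have upper: "?cov CARD('n)"
  proof (rule moment_angle_complex_categorical_cover)
    show "finite ?V" by simp
    show "\<sigma> \<subseteq> ?V" if "\<sigma> \<in> ?K" for \<sigma>
      using that vec.dependent_zero by (auto simp: nonzero_vectors_def independence_complex_def)
    show "{} \<in> ?K" by (simp add: independence_complex_def vec.independent_empty)
    show "\<tau> \<in> ?K" if "\<sigma> \<in> ?K" "\<tau> \<subseteq> \<sigma>" for \<sigma> \<tau>
      using that vec.independent_mono by (auto simp: independence_complex_def)
    show "{v} \<in> ?K" if "v \<in> ?V" for v
      using that by (simp add: nonzero_vectors_def independence_complex_def)
    show "card \<sigma> \<le> CARD('n)" if "\<sigma> \<in> ?K" for \<sigma>
      using that vec.independent_card_le_dim[of \<sigma> UNIV]
      by (simp add: independence_complex_def card_cart_basis)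
  qed
  \<comment> \<open>Here p > 2 enters: a third scalar supplies a second vertex on every
    axis.\<close>
  have "{0, 1 :: 'p mod_ring} \<noteq> UNIV"
  proof
    assume eq: "{0, 1 :: 'p mod_ring} = UNIV"
    have "CARD('p mod_ring) = card {0, 1 :: 'p mod_ring}" by (simp only: eq)
    then show False using assms by simp
  qed
  then obtain c :: "'p mod_ring" where c: "c \<noteq> 0" "c \<noteq> 1" by blast
  have lower: "CARD('n) \<le> k" if "?cov k" for k
  proof -
    obtain U where U: "\<And>i. i \<le> k \<Longrightarrow> openin ?Z (U i)" "\<And>i. i \<le> k \<Longrightarrow> contractible_in ?Z (U i)"
      "(\<Union>i\<le>k. U i) = topspace ?Z"
      using \<open>?cov k\<close> by blast
    show ?thesis
    proof (rule moment_angle_complex_no_small_cover[where a = "\<lambda>i. axis i 1" and b = "\<lambda>i. axis i c", OF _ _ _ _ _ _ _ U])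
      show "axis i 1 \<in> ?V" "axis i c \<in> ?V" for i
        using c by (simp_all add: nonzero_vectors_def axis_eq_0_iff)
      show "inj (\<lambda>i. axis i 1 :: 'p mod_ring ^ 'n)" "inj (\<lambda>i. axis i c :: 'p mod_ring ^ 'n)"
        using c by (auto simp: inj_def axis_eq_axis)
      show "range (\<lambda>i. axis i 1 :: 'p mod_ring ^ 'n) \<inter> range (\<lambda>i. axis i c) = {}"
        using c by (auto simp: axis_eq_axis)
      show "axis i c \<notin> \<sigma>" if "\<sigma> \<in> ?K" "axis i 1 \<in> \<sigma>" for i \<sigma>
        using independent_axis_scalar_unique[of \<sigma> i c] that c by (auto simp: independence_complex_def)
      show "\<sigma> \<in> ?K"
        if sub: "\<sigma> \<subseteq> range (\<lambda>i. axis i 1) \<union> range (\<lambda>i. axis i c)"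
          and pair: "\<And>i. axis i 1 \<in> \<sigma> \<Longrightarrow> axis i c \<notin> \<sigma>" for \<sigma>
      proof -
        have "vec.independent \<sigma>"
        proof (rule independent_axes)
          show "\<exists>i d. d \<noteq> 0 \<and> v = axis i d" if "v \<in> \<sigma>" for v
            using sub that c by (metis (no_types, lifting) UnE imageE subsetD zero_neq_one)
          have "d = 1 \<or> d = c \<or> d = 0" if "axis i d \<in> \<sigma>" for i d
            using subsetD[OF sub that] by (auto simp: axis_eq_axis)
          moreover have "d \<noteq> 0" if "axis i d \<in> \<sigma>" for i d
            using subsetD[OF sub that] c by (auto simp: axis_eq_axis)
          ultimately show "d = d'" if "axis i d \<in> \<sigma>" "axis i d' \<in> \<sigma>" for i d d'
            using that pair by metis
        qed simp
        then show ?thesis by (simp add: independence_complex_def)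
      qed
    qed
  qed
  have "LS_category ?Z = Inf (enat ` {k. ?cov k})" by (simp add: LS_category_def)
  also have "\<dots> = enat CARD('n)"
  proof (rule antisym)
    show "Inf (enat ` {k. ?cov k}) \<le> enat CARD('n)" using upper by (intro Inf_lower imageI CollectI)
    show "enat CARD('n) \<le> Inf (enat ` {k. ?cov k})"
    proof (rule Inf_greatest)
      fix y assume "y \<in> enat ` {k. ?cov k}"
      then obtain k where "?cov k" "y = enat k" by blast
      then show "enat CARD('n) \<le> y" using lower[of k] by simp
    qed
  qed
  finally show ?thesis .
qed

end
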